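(* For any trip $r\in T$, if $\min_{h,l\in H}\{d_{or^rh}+d_{lde^r}\}\ge d_{or^rde^r}$, then trip $r$ will be served with on-demand shuttles only; that is, under every ODMTS design $\mathbf z$, the optimal route of $r$ uses no bus leg.
   Context: $N$ is a finite set of nodes, $H\subseteq N$ the set of hubs, $T$ the set of trips. Each trip $r$ has distinct origin $or^r$ and destination $de^r$ in $N\setminus H$. For $i,j\in N$, $t_{ij}\ge0$ and $d_{ij}\ge0$ are travel time and distance (possibly asymmetric), each satisfying the triangle inequality. $\theta\in[0,1]$, $g\ge0$ is the shuttle cost per mile, $s>0$ the average bus waiting time. Put $\gamma^r_{ij}=(1-\theta)g\,d_{ij}+\theta t_{ij}$ and $\tau^r_{hl}=\theta(t_{hl}+s)$. An ODMTS design is a $\mathbf z\in\{0,1\}^{|H|\times|H|}$ ($z_{hl}=1$ iff the bus leg from $h$ to $l$ is open). Given $\mathbf z$, the optimal route of $r$ is a solution of: lexicographically minimize $\langle b^r,f^r\rangle$ (first $b^r$, then $f^r$) over binary $x^r_{hl}$ ($h,l\in H$) and $y^r_{ij}$ ($(i,j)\in A^r$), with $b^r=\sum\tau^r_{hl}x^r_{hl}+\sum\gamma^r_{ij}y^r_{ij}$, $f^r=\sum(t_{hl}+s)x^r_{hl}+\sum t_{ij}y^r_{ij}$, subject to $x^r_{hl}\le z_{hl}$ and unit flow conservation from $or^r$ to $de^r$ over bus legs ($x$) and shuttle legs ($y$). Here $A^r=\{(or^r,h),(h,de^r):h\in H\}\cup\{(or^r,de^r)\}$ (other shuttle arcs are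 unnecessary by the triangle inequality). A route is either a direct shuttle ride from $or^r$ to $de^r$, or a shuttle from $or^r$ to a hub, bus leg(s) between hubs, and a shuttle from a hub to $de^r$. *)

theory Defs
  imports Complex_Main
begin

record ('n, 'r) odmts =
  nodes :: "'n set"
  hubs :: "'n set"
  trips :: "'r set"
  orig :: "'r \<Rightarrow> 'n"
  dest :: "'r \<Rightarrow> 'n"
  travel_time :: "'n \<Rightarrow> 'n \<Rightarrow> real"
  distance :: "'n \<Rightarrow> 'n \<Rightarrow> real"
  theta :: real
  mile_cost :: real  \<comment> \<open>shuttle cost per mile\<close>
  bus_wait :: real  \<comment> \<open>average bus waiting time\<close>

definition triangle_on :: "'n set \<Rightarrow> ('n \<Rightarrow> 'n \<Rightarrow> real) \<Rightarrow> bool" where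
  "triangle_on N c \<longleftrightarrow> (\<forall>i\<in>N. \<forall>j\<in>N. \<forall>k\<in>N. c i k \<le> c i j + c j k)"

definition valid_odmts :: "('n, 'r) odmts \<Rightarrow> bool" where
  "valid_odmts I \<longleftrightarrow>
     finite (nodes I) \<and> hubs I \<subseteq> nodes I \<and>
     (\<forall>r\<in>trips I. orig I r \<in> nodes I - hubs I \<and> dest I r \<in> nodes I - hubs I \<and>
        orig I r \<noteq> dest I r) \<and>
     (\<forall>i\<in>nodes I. \<forall>j\<in>nodes I. 0 \<le> travel_time I i j \<and> 0 \<le> distance I i j) \<and>
     triangle_on (nodes I) (travel_time I) \<and> triangle_on (nodes I) (distance I) \<and>
     0 \<le> theta I \<and> theta I \<le> 1 \<and> 0 \<le> mile_cost I \<and> 0 < bus_wait I"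

definition gamma :: "('n, 'r) odmts \<Rightarrow> 'n \<Rightarrow> 'n \<Rightarrow> real" where
  "gamma I i j = (1 - theta I) * mile_cost I * distance I i j + theta I * travel_time I i j"

definition tau :: "('n, 'r) odmts \<Rightarrow> 'n \<Rightarrow> 'n \<Rightarrow> real" where
  "tau I h l = theta I * (travel_time I h l + bus_wait I)"

text \<open>Designs and route variables are 0/1-valued functions; only their values on
  \<open>hubs I \<times> hubs I\<close> (bus legs) and on \<open>shuttle_arcs I r\<close> (shuttle legs) matter.\<close>

definition is_design :: "('n, 'r) odmts \<Rightarrow> ('n \<Rightarrow> 'n \<Rightarrow> real) \<Rightarrow> bool" where
  "is_design I z \<longleftrightarrow> (\<forall>h\<in>hubs I. \<forall>l\<in>hubs I. z h l \<in> {0, 1})"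

definition shuttle_arcs :: "('n, 'r) odmts \<Rightarrow> 'r \<Rightarrow> ('n \<times> 'n) set" where
  "shuttle_arcs I r =
     {(orig I r, h) | h. h \<in> hubs I} \<union> {(h, dest I r) | h. h \<in> hubs I} \<union> {(orig I r, dest I r)}"

definition outflow :: "('n, 'r) odmts \<Rightarrow> 'r \<Rightarrow> ('n \<Rightarrow> 'n \<Rightarrow> real) \<Rightarrow> ('n \<Rightarrow> 'n \<Rightarrow> real) \<Rightarrow> 'n \<Rightarrow> real" where
  "outflow I r x y i =
     (\<Sum>(h, l)\<in>{a \<in> hubs I \<times> hubs I. fst a = i}. x h l) +
     (\<Sum>(u, v)\<in>{a \<in> shuttle_arcs I r. fst a = i}. y u v)"

definition inflow :: "('n, 'r) odmts \<Rightarrow> 'r \<Rightarrow> ('n \<Rightarrow> 'n \<Rightarrow> real) \<Rightarrow> ('n \<Rightarrow> 'n \<Rightarrow> real) \<Rightarrow> 'n \<Rightarrow> real" where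
  "inflow I r x y i =
     (\<Sum>(h, l)\<in>{a \<in> hubs I \<times> hubs I. snd a = i}. x h l) +
     (\<Sum>(u, v)\<in>{a \<in> shuttle_arcs I r. snd a = i}. y u v)"

definition feasible_route ::
  "('n, 'r) odmts \<Rightarrow> ('n \<Rightarrow> 'n \<Rightarrow> real) \<Rightarrow> 'r \<Rightarrow> ('n \<Rightarrow> 'n \<Rightarrow> real) \<Rightarrow> ('n \<Rightarrow> 'n \<Rightarrow> real) \<Rightarrow> bool" where
  "feasible_route I z r x y \<longleftrightarrow>
     (\<forall>h\<in>hubs I. \<forall>l\<in>hubs I. x h l \<in> {0, 1} \<and> x h l \<le> z h l) \<and>
     (\<forall>(i, j)\<in>shuttle_arcs I r. y i j \<in> {0, 1}) \<and>
     (\<forall>i\<in>nodes I. outflow I r x y i - inflow I r x y i =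
        (if i = orig I r then 1 else if i = dest I r then -1 else 0))"

definition route_b ::
  "('n, 'r) odmts \<Rightarrow> 'r \<Rightarrow> ('n \<Rightarrow> 'n \<Rightarrow> real) \<Rightarrow> ('n \<Rightarrow> 'n \<Rightarrow> real) \<Rightarrow> real" where
  "route_b I r x y =
     (\<Sum>(h, l)\<in>hubs I \<times> hubs I. tau I h l * x h l) +
     (\<Sum>(i, j)\<in>shuttle_arcs I r. gamma I i j * y i j)"

definition route_f ::
  "('n, 'r) odmts \<Rightarrow> 'r \<Rightarrow> ('n \<Rightarrow> 'n \<Rightarrow> real) \<Rightarrow> ('n \<Rightarrow> 'n \<Rightarrow> real) \<Rightarrow> real" where
  "route_f I r x y =
     (\<Sum>(h, l)\<in>hubs I \<times> hubs I. (travel_time I h l + bus_wait I) * x h l) +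
     (\<Sum>(i, j)\<in>shuttle_arcs I r. travel_time I i j * y i j)"

definition optimal_route ::
  "('n, 'r) odmts \<Rightarrow> ('n \<Rightarrow> 'n \<Rightarrow> real) \<Rightarrow> 'r \<Rightarrow> ('n \<Rightarrow> 'n \<Rightarrow> real) \<Rightarrow> ('n \<Rightarrow> 'n \<Rightarrow> real) \<Rightarrow> bool" where
  "optimal_route I z r x y \<longleftrightarrow>
     feasible_route I z r x y \<and>
     (\<forall>x' y'. feasible_route I z r x' y' \<longrightarrow>
        route_b I r x y < route_b I r x' y' \<or>
        (route_b I r x y = route_b I r x' y' \<and> route_f I r x y \<le> route_f I r x' y'))"

end

theory Submission
  imports Defs
begin

text \<open>A feasible route is compared with the direct shuttle ride. Weighting the flow conservation
  at each hub by its travel time to the destination shows that every feasible route takes at least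
  the direct travel time, plus one waiting time per bus leg. The distance hypothesis says that the
  shuttle legs alone are never shorter than the direct ride. Hence the direct ride is no worse in
  the weighted cost, and a route with a bus leg is strictly worse in travel time, so it loses the
  lexicographic comparison.\<close>

section \<open>Sums over pairs and summation by parts\<close>

lemma sum_over_pairs_with_fst:
  assumes "finite A" "finite B" "i \<in> A"
  shows "(\<Sum>(h, l)\<in>{a \<in> A \<times> B. fst a = i}. f h l) = (\<Sum>l\<in>B. f i l :: real)"
proof -
  have "{a \<in> A \<times> B. fst a = i} = {i} \<times> B" using assms by auto
  then show ?thesis by (simp add: sum.cartesian_product[symmetric])
qed

lemma sum_over_pairs_with_snd:
  assumes "finite A" "finite B" "i \<in> B"
  shows "(\<Sum>(h, l)\<in>{a \<in> A \<times> B. snd a = i}. f h l) = (\<Sum>h\<in>A. f h i :: real)"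
proof -
  have "{a \<in> A \<times> B. snd a = i} = A \<times> {i}" using assms by auto
  then show ?thesis by (simp add: sum.cartesian_product[symmetric])
qed

text \<open>Discrete summation by parts: exchanging the summation order in the \<open>p l\<close>
  terms moves the potential from the legs to the net outflow of each node.\<close>

lemma potential_difference_sum:
  fixes x :: "'a \<Rightarrow> 'a \<Rightarrow> real" and p :: "'a \<Rightarrow> real"
  shows "(\<Sum>h\<in>H. \<Sum>l\<in>H. (p h - p l) * x h l) = (\<Sum>h\<in>H. p h * ((\<Sum>l\<in>H. x h l) - (\<Sum>l\<in>H. x l h)))"
proof -
  have "(\<Sum>h\<in>H. \<Sum>l\<in>H. p l * x h l) = (\<Sum>h\<in>H. \<Sum>l\<in>H. p h * x l h)"
    by (rule sum.swap)
  then show ?thesis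
    by (simp add: left_diff_distrib right_diff_distrib sum_subtractf sum_distrib_left)
qed

section \<open>Shuttle arcs and flow balance of a single trip\<close>

locale odmts_trip =
  fixes I :: "('n, 'r) odmts" and r :: 'r
  assumes valid: "valid_odmts I" and trip: "r \<in> trips I"
begin

abbreviation "H \<equiv> hubs I"
abbreviation "src \<equiv> orig I r"
abbreviation "dst \<equiv> dest I r"

lemma finite_hubs: "finite H"
  using valid finite_subset by (auto simp: valid_odmts_def)

lemma endpoints: "src \<in> nodes I" "dst \<in> nodes I" "src \<notin> H" "dst \<notin> H" "src \<noteq> dst"
  using valid trip by (auto simp: valid_odmts_def)

lemma hub_node: "h \<in> H \<Longrightarrow> h \<in> nodes I"
  using valid by (auto simp: valid_odmts_def)

lemma time_triangle:
  "i \<in> nodes I \<Longrightarrow> j \<in> nodes I \<Longrightarrow> k \<in> nodes I \<Longrightarrow>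
    travel_time I i k \<le> travel_time I i j + travel_time I j k"
  using valid by (auto simp: valid_odmts_def triangle_on_def)

lemma parameters: "0 \<le> theta I" "theta I \<le> 1" "0 \<le> mile_cost I" "0 < bus_wait I"
  using valid by (auto simp: valid_odmts_def)

lemma finite_shuttle_arcs: "finite (shuttle_arcs I r)"
  using finite_hubs by (simp add: shuttle_arcs_def)

text \<open>The three families of arcs are disjoint because neither endpoint of the trip is a
  hub.\<close>

lemma sum_shuttle_arcs:
  fixes f :: "'n \<Rightarrow> 'n \<Rightarrow> real"
  shows "(\<Sum>(i, j)\<in>shuttle_arcs I r. f i j) = (\<Sum>h\<in>H. f src h) + (\<Sum>h\<in>H. f h dst) + f src dst"
proof -
  have eq: "shuttle_arcs I r = {src} \<times> H \<union> H \<times> {dst} \<union> {(src, dst)}"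
    by (auto simp: shuttle_arcs_def)
  show ?thesis
    unfolding eq using finite_hubs endpoints
    by (subst sum.union_disjoint, simp, simp, blast)+
      (simp add: sum.cartesian_product[symmetric])
qed

lemma sum_shuttle_arcs_filter:
  fixes f :: "'n \<Rightarrow> 'n \<Rightarrow> real"
  shows "(\<Sum>(i, j)\<in>{a \<in> shuttle_arcs I r. P a}. f i j) =
    (\<Sum>h\<in>H. if P (src, h) then f src h else 0) + (\<Sum>h\<in>H. if P (h, dst) then f h dst else 0) +
    (if P (src, dst) then f src dst else 0)"
proof -
  have "(\<Sum>(i, j)\<in>{a \<in> shuttle_arcs I r. P a}. f i j) =
      (\<Sum>(i, j)\<in>shuttle_arcs I r. if P (i, j) then f i j else 0)"
    by (simp add: sum.inter_filter[OF finite_shuttle_arcs] case_prod_unfold)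
  then show ?thesis by (simp only: sum_shuttle_arcs)
qed

text \<open>No bus leg touches \<open>src\<close>, since it is not a hub, and shuttle arcs only
  leave it.\<close>

lemma net_outflow_src: "outflow I r x y src - inflow I r x y src = (\<Sum>h\<in>H. y src h) + y src dst"
proof -
  have bus: "{a \<in> H \<times> H. fst a = src} = {}" "{a \<in> H \<times> H. snd a = src} = {}"
    using endpoints by auto
  have "(\<Sum>h\<in>H. if h = src then f h else 0) = (0 :: real)" for f
    using endpoints by (auto intro!: sum.neutral)
  then show ?thesis
    unfolding outflow_def inflow_def sum_shuttle_arcs_filter bus
    using endpoints by simp
qed

lemma net_outflow_dst: "outflow I r x y dst - inflow I r x y dst = - (\<Sum>h\<in>H. y h dst) - y src dst"
proof -
  have bus: "{a \<in> H \<times> H. fst a = dst} = {}" "{a \<in> H \<times> H. snd a = dst} = {}"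
    using endpoints by auto
  have "(\<Sum>h\<in>H. if h = dst then f h else 0) = (0 :: real)" for f
    using endpoints by (auto intro!: sum.neutral)
  then show ?thesis
    unfolding outflow_def inflow_def sum_shuttle_arcs_filter bus
    using endpoints by simp
qed

lemma net_outflow_hub:
  assumes "i \<in> H"
  shows "outflow I r x y i - inflow I r x y i =
    ((\<Sum>l\<in>H. x i l) + y i dst) - ((\<Sum>h\<in>H. x h i) + y src i)"
proof -
  have "i \<noteq> src" "i \<noteq> dst" using assms endpoints by auto
  then show ?thesis
    unfolding outflow_def inflow_def sum_shuttle_arcs_filter
    using assms finite_hubs
    by (simp add: sum_over_pairs_with_fst sum_over_pairs_with_snd)
qed

section \<open>The direct ride as a feasible route\<close>

definition direct :: "'n \<Rightarrow> 'n \<Rightarrow> real" where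
  "direct i j = (if i = src \<and> j = dst then 1 else 0)"

lemma direct_simps [simp]:
  "direct src dst = 1" "h \<in> H \<Longrightarrow> direct src h = 0" "h \<in> H \<Longrightarrow> direct h j = 0"
  using endpoints by (auto simp: direct_def)

lemma feasible_direct:
  assumes "is_design I z"
  shows "feasible_route I z r (\<lambda>_ _. 0) direct"
proof -
  have net: "outflow I r (\<lambda>_ _. 0) direct i - inflow I r (\<lambda>_ _. 0) direct i =
      (if i = src then 1 else if i = dst then - 1 else 0)" for i
  proof (cases "i \<in> H \<or> i = src \<or> i = dst")
    case True
    then show ?thesis
      using net_outflow_src[of "\<lambda>_ _. 0" direct] net_outflow_dst[of "\<lambda>_ _. 0" direct]
        net_outflow_hub[of i "\<lambda>_ _. 0" direct] endpoints by auto
  next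
    case False
    then have "(if h = i then direct h j else 0) = 0" if "h \<in> H" for h j
      using that by auto
    with False show ?thesis
      unfolding outflow_def inflow_def sum_shuttle_arcs_filter
      by (auto simp: case_prod_unfold intro!: sum.neutral)
  qed
  moreover have "0 \<le> z h l" if "h \<in> H" "l \<in> H" for h l
    using assms that unfolding is_design_def by fastforce
  ultimately show ?thesis
    by (auto simp: feasible_route_def direct_def)
qed

lemma route_b_direct: "route_b I r (\<lambda>_ _. 0) direct = gamma I src dst"
  by (simp add: route_b_def sum_shuttle_arcs)

lemma route_f_direct: "route_f I r (\<lambda>_ _. 0) direct = travel_time I src dst"
  by (simp add: route_f_def sum_shuttle_arcs)

section \<open>Lower bounds for an arbitrary feasible route\<close>

context
  fixes z x y
  assumes feasible: "feasible_route I z r x y"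
begin

lemma bus_binary: "h \<in> H \<Longrightarrow> l \<in> H \<Longrightarrow> x h l \<in> {0, 1}"
  using feasible by (simp add: feasible_route_def)

lemma bus_nonneg: "h \<in> H \<Longrightarrow> l \<in> H \<Longrightarrow> 0 \<le> x h l"
  using bus_binary by fastforce

lemma shuttle_binary:
  "h \<in> H \<Longrightarrow> y src h \<in> {0, 1}" "h \<in> H \<Longrightarrow> y h dst \<in> {0, 1}" "y src dst \<in> {0, 1}"
  using feasible by (auto simp: feasible_route_def shuttle_arcs_def)

lemma shuttle_nonneg: "h \<in> H \<Longrightarrow> 0 \<le> y src h" "h \<in> H \<Longrightarrow> 0 \<le> y h dst"
  using shuttle_binary by fastforce+

lemma flow_src: "(\<Sum>h\<in>H. y src h) + y src dst = 1"
proof -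
  have "outflow I r x y src - inflow I r x y src = 1"
    using feasible endpoints by (simp add: feasible_route_def)
  then show ?thesis by (simp add: net_outflow_src)
qed

lemma flow_dst: "(\<Sum>h\<in>H. y h dst) + y src dst = 1"
proof -
  have "outflow I r x y dst - inflow I r x y dst = - 1"
    using feasible endpoints by (auto simp: feasible_route_def)
  then show ?thesis by (simp add: net_outflow_dst)
qed

lemma flow_hub:
  assumes "h \<in> H"
  shows "(\<Sum>l\<in>H. x h l) - (\<Sum>l\<in>H. x l h) = y src h - y h dst"
proof -
  have "h \<noteq> src" "h \<noteq> dst" using assms endpoints by auto
  then have "outflow I r x y h - inflow I r x y h = 0"
    using feasible hub_node[OF assms] by (simp add: feasible_route_def)
  then show ?thesis using net_outflow_hub[OF assms, of x y] by simp
qed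

text \<open>The travel time to \<open>dst\<close> acts as a potential \<open>?p\<close>: by the
  triangle inequality its drop along a bus leg is at most the time of that leg, and flow
  conservation turns the total drop into a sum over shuttle legs. The flow is never decomposed into
  paths, so cycles of bus legs are covered as well.\<close>

lemma moving_time_ge_direct:
  "travel_time I src dst \<le> (\<Sum>(h, l)\<in>H \<times> H. travel_time I h l * x h l) +
    (\<Sum>(i, j)\<in>shuttle_arcs I r. travel_time I i j * y i j)"
proof -
  let ?t = "travel_time I" and ?p = "\<lambda>h. travel_time I h dst"
  have "(\<Sum>h\<in>H. ?p h * (y src h - y h dst)) = (\<Sum>h\<in>H. \<Sum>l\<in>H. (?p h - ?p l) * x h l)"
    unfolding potential_difference_sum by (intro sum.cong) (simp_all add: flow_hub)
  also have "\<dots> \<le> (\<Sum>h\<in>H. \<Sum>l\<in>H. ?t h l * x h l)"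
  proof (intro sum_mono mult_right_mono)
    fix h l assume "h \<in> H" "l \<in> H"
    then show "?p h - ?p l \<le> ?t h l"
      using time_triangle[of h l dst] hub_node endpoints by auto
  qed (rule bus_nonneg)
  finally have bus: "(\<Sum>h\<in>H. ?p h * (y src h - y h dst)) \<le> (\<Sum>(h, l)\<in>H \<times> H. ?t h l * x h l)"
    by (simp add: sum.cartesian_product)
  have "?t src dst * (\<Sum>h\<in>H. y src h) \<le> (\<Sum>h\<in>H. (?t src h + ?p h) * y src h)"
    unfolding sum_distrib_left
    using time_triangle hub_node endpoints shuttle_nonneg
    by (intro sum_mono mult_right_mono) auto
  \<comment> \<open>Adding and subtracting \<open>?p h * y h dst\<close> isolates the sum bounded in
    \<open>bus\<close>; the added term is exactly the time of the shuttle leg from \<open>h\<close>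
    to \<open>dst\<close>.\<close>
  also have "\<dots> = (\<Sum>h\<in>H. ?p h * (y src h - y h dst)) + (\<Sum>h\<in>H. ?t src h * y src h) +
      (\<Sum>h\<in>H. ?t h dst * y h dst)"
    by (simp add: algebra_simps sum.distrib sum_subtractf)
  \<comment> \<open>The direct arc contributes the same term to both sides and completes the factor
    that \<open>flow_src\<close> evaluates to 1.\<close>
  finally have "?t src dst * ((\<Sum>h\<in>H. y src h) + y src dst) \<le>
      (\<Sum>(h, l)\<in>H \<times> H. ?t h l * x h l) + (\<Sum>(i, j)\<in>shuttle_arcs I r. ?t i j * y i j)"
    using bus by (simp add: sum_shuttle_arcs distrib_left)
  then show ?thesis by (simp add: flow_src)
qed

lemma shuttle_distance_ge_direct:
  assumes "\<And>h l. h \<in> H \<Longrightarrow> l \<in> H \<Longrightarrow> distance I src dst \<le> distance I src h + distance I l dst"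
  shows "distance I src dst \<le> (\<Sum>(i, j)\<in>shuttle_arcs I r. distance I i j * y i j)"
proof -
  let ?d = "distance I"
  show ?thesis
  proof (cases "y src dst = 0")
    case True
    then have one: "(\<Sum>h\<in>H. y src h) = 1" "(\<Sum>l\<in>H. y l dst) = 1"
      using flow_src flow_dst by auto
    \<comment> \<open>The products \<open>y src h * y l dst\<close> are weights on hub pairs with
      total 1, so the hypothesis can be averaged over all pairs without naming the first and last
      hub.\<close>
    have "?d src dst = ?d src dst * ((\<Sum>h\<in>H. y src h) * (\<Sum>l\<in>H. y l dst))"
      by (simp add: one)
    also have "\<dots> = (\<Sum>h\<in>H. \<Sum>l\<in>H. ?d src dst * (y src h * y l dst))"
      unfolding sum_product by (simp add: sum_distrib_left)
    also have "\<dots> \<le> (\<Sum>h\<in>H. \<Sum>l\<in>H. (?d src h + ?d l dst) * (y src h * y l dst))"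
      using assms shuttle_nonneg by (intro sum_mono mult_right_mono) auto
    also have "\<dots> = (\<Sum>h\<in>H. ?d src h * y src h) * (\<Sum>l\<in>H. y l dst) +
        (\<Sum>h\<in>H. y src h) * (\<Sum>l\<in>H. ?d l dst * y l dst)"
      unfolding sum_product sum.distrib[symmetric] by (intro sum.cong) (simp_all add: algebra_simps)
    finally show ?thesis by (simp add: one True sum_shuttle_arcs)
  next
    case False
    then have w: "y src dst = 1" using shuttle_binary by auto
    then have "(\<Sum>h\<in>H. y src h) = 0" "(\<Sum>h\<in>H. y h dst) = 0"
      using flow_src flow_dst by auto
    then have "\<forall>h\<in>H. y src h = 0" "\<forall>h\<in>H. y h dst = 0"
      using sum_nonneg_eq_0_iff[OF finite_hubs, of "\<lambda>h. y src h"]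
        sum_nonneg_eq_0_iff[OF finite_hubs, of "\<lambda>h. y h dst"] shuttle_nonneg by auto
    then show ?thesis by (simp add: w sum_shuttle_arcs)
  qed
qed

lemma route_f_ge_direct_plus_waiting:
  "travel_time I src dst + bus_wait I * (\<Sum>(h, l)\<in>H \<times> H. x h l) \<le> route_f I r x y"
  using moving_time_ge_direct
  by (simp add: route_f_def distrib_right sum.distrib sum_distrib_left case_prod_unfold)

lemma bus_count_nonneg: "0 \<le> (\<Sum>(h, l)\<in>H \<times> H. x h l)"
  using bus_nonneg by (auto intro!: sum_nonneg)

lemma bus_count_pos:
  assumes "h \<in> H" "l \<in> H" "x h l \<noteq> 0"
  shows "0 < (\<Sum>(h, l)\<in>H \<times> H. x h l)"
  using assms bus_nonneg finite_hubs
  by (intro sum_pos2[where i = "(h, l)"]) (auto simp: order_less_le)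

text \<open>Bus legs are charged for time only, so distance enters the weighted cost through shuttle
  arcs alone.\<close>

lemma route_b_decomposition:
  "route_b I r x y = theta I * route_f I r x y +
    (1 - theta I) * mile_cost I * (\<Sum>(i, j)\<in>shuttle_arcs I r. distance I i j * y i j)"
  by (simp add: route_b_def route_f_def tau_def gamma_def case_prod_unfold sum_distrib_left
      sum.distrib[symmetric] algebra_simps)

lemma route_b_ge_direct:
  assumes "\<And>h l. h \<in> H \<Longrightarrow> l \<in> H \<Longrightarrow> distance I src dst \<le> distance I src h + distance I l dst"
  shows "gamma I src dst \<le> route_b I r x y"
proof -
  have "travel_time I src dst \<le> route_f I r x y"
    using route_f_ge_direct_plus_waiting mult_nonneg_nonneg[OF _ bus_count_nonneg, of "bus_wait I"]
      parameters by linarith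
  moreover note shuttle_distance_ge_direct[OF assms]
  \<comment> \<open>Both bounds are scaled by nonnegative weights and added; commuting one sum
    aligns the time and distance terms.\<close>
  ultimately show ?thesis
    unfolding route_b_decomposition gamma_def
    using parameters by (subst add.commute) (intro add_mono mult_left_mono mult_nonneg_nonneg; simp)
qed

end

end

section \<open>Lexicographic comparison with the direct ride\<close>

theorem corollary2:
  fixes I :: "('n, 'r) odmts" and r :: 'r
  assumes "valid_odmts I"
    and "r \<in> trips I"
    and "Min ((\<lambda>(h, l). distance I (orig I r) h + distance I l (dest I r)) ` (hubs I \<times> hubs I))
           \<ge> distance I (orig I r) (dest I r)"
  shows "\<forall>z. is_design I z \<longrightarrow>
           (\<forall>x y. optimal_route I z r x y \<longrightarrow> (\<forall>h\<in>hubs I. \<forall>l\<in>hubs I. x h l = 0))"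
proof (intro allI impI ballI, rule ccontr)
  fix z x y h l
  assume design: "is_design I z" and opt: "optimal_route I z r x y"
    and h: "h \<in> hubs I" and l: "l \<in> hubs I" and used: "x h l \<noteq> 0"
  interpret odmts_trip I r using assms by unfold_locales
  have feas: "feasible_route I z r x y" using opt by (simp add: optimal_route_def)
  \<comment> \<open>The minimum ranges over a finite set containing the value of this pair, so it is
    a lower bound for that value.\<close>
  have far: "distance I src dst \<le> distance I src h + distance I l dst" if "h \<in> H" "l \<in> H" for h l
  proof -
    have "Min ((\<lambda>(h, l). distance I src h + distance I l dst) ` (H \<times> H))
        \<le> distance I src h + distance I l dst"
      using that finite_hubs by (intro Min_le) force+
    with assms(3) show ?thesis by linarith
  qed
  have "gamma I src dst \<le> route_b I r x y"
    by (rule route_b_ge_direct[OF feas far])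
  \<comment> \<open>Strictness comes from the positive waiting time of the used leg. It is sought in
    \<open>route_f\<close> because \<open>route_b\<close> can tie with the direct ride, for instance
    when \<open>theta I\<close> is 0.\<close>
  moreover have "travel_time I src dst < route_f I r x y"
    using route_f_ge_direct_plus_waiting[OF feas] parameters(4)
      mult_pos_pos[OF parameters(4) bus_count_pos[OF feas h l used]] by linarith
  moreover have "route_b I r x y < gamma I src dst \<or>
      (route_b I r x y = gamma I src dst \<and> route_f I r x y \<le> travel_time I src dst)"
    using opt feasible_direct[OF design]
    unfolding optimal_route_def route_b_direct[symmetric] route_f_direct[symmetric] by blast
  ultimately show False by linarith
qed

end
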